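(* Let $(F_n)_{n\ge 0}$ be the finite Fibonacci strings defined by $F_0=b$, $F_1=a$, $F_n=F_{n-1}F_{n-2}$ for $n\ge 2$. The set of all left seeds of $F_n$ is: (i) $\{F_n\}$ if $n\in\{0,1,2\}$; (ii) $\{ab,aba\}$ if $n=3$; (iii) $\{F_{n-1}x : x \text{ a possibly empty prefix of } F_{n-2}\}\ \cup\ \bigcup_{m=3}^{n-2}\{F_m x : x\text{ a possibly empty prefix of }F_{m-1}[1\ldots |F_{m-1}|-2]\}$ if $n\ge 4$.
   Context: Strings are over the alphabet $\{a,b\}$, where $a$ and $b$ are distinct letters. $|y|$ is the length of a string $y$, and $y[i\ldots j]$ denotes its factor from position $i$ to position $j$ (positions start at 1; $y[1\ldots 0]$ is the empty string). An empty-range union is empty. A nonempty string $x$ of length $m$ is a cover of a string $y$ of length $n\ge m$ if there is a set of positions $P\subseteq\{1,\dots,n-m+1\}$ such that $y[i\ldots i+m-1]=x$ for all $i\in P$ and $\bigcup_{i\in P}\{i,\dots,i+m-1\}=\{1,\dots,n\}$; in particular $y$ is a cover of itself. A left seed of a string $y$ is a nonempty prefix of $y$ that is a cover of some string of the form $yv$, where $v$ is a possibly empty string. *)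

theory Defs
  imports Main "HOL-Library.Sublist"
begin

datatype letter = Letter_a | Letter_b

text \<open>
  The factor of \<open>y\<close> from position \<open>i\<close> to position \<open>j\<close>, both inclusive, where positions
  start at 1. It is empty if \<open>j < i\<close>; it is only meant for \<open>1 \<le> i\<close> and \<open>j \<le> length y\<close>.
\<close>

definition factor :: "'a list \<Rightarrow> nat \<Rightarrow> nat \<Rightarrow> 'a list" where
  "factor y i j = take (j + 1 - i) (drop (i - 1) y)"

definition is_cover :: "'a list \<Rightarrow> 'a list \<Rightarrow> bool" where
  "is_cover x y \<longleftrightarrow>
     x \<noteq> [] \<and> length x \<le> length y \<and>
     (\<exists>P \<subseteq> {1..length y - length x + 1}.
        (\<forall>i\<in>P. factor y i (i + length x - 1) = x) \<and>
        (\<Union>i\<in>P. {i..i + length x - 1}) = {1..length y})"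

definition left_seed :: "'a list \<Rightarrow> 'a list \<Rightarrow> bool" where
  "left_seed x y \<longleftrightarrow> x \<noteq> [] \<and> prefix x y \<and> (\<exists>v. is_cover x (y @ v))"

fun fib_string :: "nat \<Rightarrow> letter list" where
  "fib_string 0 = [Letter_b]"
| "fib_string (Suc 0) = [Letter_a]"
| "fib_string (Suc (Suc n)) = fib_string (Suc n) @ fib_string n"

end

theory Submission
  imports Defs "HOL-Library.Multiset"
begin

text \<open>
  The string \<open>F\<^sub>n\<close> factors into copies of \<open>F\<^sub>m\<close> and \<open>F\<^bsub>m-1\<^esub>\<close>. Since \<open>F\<^bsub>m-2\<^esub> F\<^bsub>m-1\<^esub>\<close> and
  \<open>F\<^bsub>m-1\<^esub> F\<^bsub>m-2\<^esub>\<close> differ only in their last two letters, \<open>F\<^sub>m x\<close> occurs at the start of every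
  such block (running over the end of \<open>F\<^sub>n\<close> at the last ones) as long as \<open>x\<close> avoids the last two
  letters of \<open>F\<^bsub>m-1\<^esub>\<close>; this gives the listed left seeds.

  Conversely, the only prefixes not listed are the \<open>F\<^sub>k\<close> without its last letter, and such a prefix
  is not even a left seed of \<open>F\<^bsub>k+1\<^esub>\<close>. Otherwise the last letter of the prefix \<open>F\<^sub>k\<close> of \<open>F\<^bsub>k+1\<^esub>\<close> is
  covered by an occurrence shifted by some \<open>j\<close> with \<open>0 < j < |F\<^sub>k|\<close>. If this occurrence lies inside
  \<open>F\<^bsub>k+1\<^esub>\<close>, which is a prefix of \<open>F\<^sub>k F\<^sub>k\<close>, then counting letters shows that \<open>F\<^sub>k\<close> equals its own
  rotation by \<open>j\<close>, although it is primitive. Otherwise \<open>j\<close> is a period of \<open>F\<^bsub>k+1\<^esub>\<close>, but the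
  smallest period of \<open>F\<^bsub>k+1\<^esub>\<close> is \<open>|F\<^sub>k|\<close>.
\<close>

section \<open>Covers and left seeds\<close>

lemma is_cover_refl: "x \<noteq> [] \<Longrightarrow> is_cover x x"
  unfolding is_cover_def by (intro conjI exI[of _ "{1}"]) (auto simp: factor_def)

lemma is_cover_imp_prefix:
  assumes "is_cover x z"
  shows "prefix x z"
proof -
  obtain P where P: "x \<noteq> []" "\<forall>i\<in>P. factor z i (i + length x - 1) = x"
      "P \<subseteq> {1..length z - length x + 1}" "length x \<le> length z"
      "(\<Union>i\<in>P. {i..i + length x - 1}) = {1..length z}"
    using assms unfolding is_cover_def by blast
  \<comment> \<open>Only an occurrence starting at position 1 can cover position 1.\<close>
  have "1 \<in> (\<Union>i\<in>P. {i..i + length x - 1})"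
    using P(1,4,5) by (cases z) auto
  then have "1 \<in> P"
    using P(3) by (force simp: le_Suc_eq)
  then have "take (length x) z = x"
    using P(1,2) by (auto simp: factor_def)
  then show ?thesis
    by (metis take_is_prefix)
qed

text \<open>The occurrences in \<open>z\<close> shift by \<open>length t\<close>, and the new one at
  position 1 leaves no gap before them because \<open>length t \<le> length x\<close>. Thus covers
  can grow to the left block by block.\<close>

lemma is_cover_append_left:
  assumes "is_cover x z" "length t \<le> length x" "prefix x (t @ z)"
  shows "is_cover x (t @ z)"
proof -
  obtain P where x: "x \<noteq> []" and occ: "\<And>i. i \<in> P \<Longrightarrow> factor z i (i + length x - 1) = x"
      and P: "P \<subseteq> {1..length z - length x + 1}" and len: "length x \<le> length z"
      and U: "(\<Union>i\<in>P. {i..i + length x - 1}) = {1..length z}"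
    using assms(1) unfolding is_cover_def by blast
  define Q where "Q = insert 1 ((\<lambda>i. i + length t) ` P)"
  have 1: "Q \<subseteq> {1..length (t @ z) - length x + 1}"
  proof
    fix i assume "i \<in> Q"
    then consider "i = 1" | j where "j \<in> P" "i = j + length t"
      by (auto simp: Q_def)
    then show "i \<in> {1..length (t @ z) - length x + 1}"
      using P len by cases (simp, fastforce)
  qed
  have 2: "factor (t @ z) i (i + length x - 1) = x" if i: "i \<in> Q" for i
  proof (cases "i = 1")
    case True
    obtain u where u: "t @ z = x @ u" using assms(3) by (auto simp: prefix_def)
    show ?thesis unfolding True u using x by (simp add: factor_def)
  next
    case False
    then obtain j where j: "j \<in> P" "i = j + length t"
      using i by (auto simp: Q_def)
    moreover have "1 \<le> j" using j P by auto
    ultimately show ?thesis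
      using occ[OF j(1)] x by (auto simp: factor_def)
  qed
  have "(\<Union>i\<in>P. {i + length t..i + length t + length x - 1})
      = (\<lambda>i. i + length t) ` (\<Union>i\<in>P. {i..i + length x - 1})"
    using x by (simp add: image_UN) (intro SUP_cong refl, cases x, auto)
  also have "\<dots> = {1 + length t..length z + length t}"
    unfolding U by (rule image_add_atLeastAtMost')
  finally have "(\<Union>i\<in>Q. {i..i + length x - 1})
      = {1..length x} \<union> {1 + length t..length z + length t}"
    by (simp add: Q_def)
  also have "\<dots> = {1..length (t @ z)}"
    using assms(2) len by auto
  finally show ?thesis
    unfolding is_cover_def using x len 1 2 by (intro conjI exI[of _ Q]) auto
qed

lemma left_seed_refl: "x \<noteq> [] \<Longrightarrow> left_seed x x"
  unfolding left_seed_def using is_cover_refl[of x] by (metis append_Nil2 prefix_order.order_refl)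

lemma left_seed_prefix:
  assumes "left_seed x y" "prefix x y'" "prefix y' y"
  shows "left_seed x y'"
  using assms unfolding left_seed_def prefix_def by (metis append.assoc)

lemma left_seedI:
  assumes "is_cover x z" "prefix y z" "prefix x y"
  shows "left_seed x y"
  using assms unfolding left_seed_def is_cover_def prefix_def by blast

lemma left_seed_covers:
  assumes "left_seed x y" "p < length y"
  obtains v j where "j \<le> p" "p < j + length x" "take (length x) (drop j (y @ v)) = x"
proof -
  obtain v P where x: "x \<noteq> []" and
      occ: "\<And>i. i \<in> P \<Longrightarrow> factor (y @ v) i (i + length x - 1) = x" and
      P: "P \<subseteq> {1..length (y @ v) - length x + 1}" and
      U: "(\<Union>i\<in>P. {i..i + length x - 1}) = {1..length (y @ v)}"
    using assms(1) unfolding left_seed_def is_cover_def by blast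
  have "Suc p \<in> (\<Union>i\<in>P. {i..i + length x - 1})"
    unfolding U using assms(2) by auto
  then obtain i where i: "i \<in> P" "i \<le> Suc p" "Suc p \<le> i + length x - 1"
    by auto
  moreover have "1 \<le> i" using i P by auto
  then obtain j where "i = Suc j" by (cases i) auto
  moreover have "0 < length x" using x by simp
  ultimately show ?thesis
    using occ[OF i(1)] that[of j v] by (auto simp: factor_def)
qed

section \<open>Fibonacci strings\<close>

abbreviation F :: "nat \<Rightarrow> letter list" where "F \<equiv> fib_string"

abbreviation f :: "nat \<Rightarrow> nat" where "f n \<equiv> length (fib_string n)"

lemma fib_string_rec: "2 \<le> n \<Longrightarrow> F n = F (n - 1) @ F (n - 2)"
  by (cases n rule: fib_string.cases) auto

lemma length_fib_string_pos: "0 < f n"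
  by (induction n rule: fib_string.induct) auto

lemma fib_string_nonempty: "F n \<noteq> []"
  using length_fib_string_pos[of n] by auto

lemma prefix_fib_string_Suc: "1 \<le> n \<Longrightarrow> prefix (F n) (F (Suc n))"
  by (cases n) auto

lemma prefix_fib_string:
  assumes "1 \<le> m" "m \<le> n"
  shows "prefix (F m) (F n)"
  using assms(2)
proof (induction n rule: dec_induct)
  case (step n)
  then show ?case
    using prefix_fib_string_Suc[of n] assms(1) by (meson order_trans prefix_order.trans)
qed simp

lemma length_fib_string_ge_2: "2 \<le> n \<Longrightarrow> 2 \<le> f n"
  using prefix_length_le[OF prefix_fib_string[of 2 n]] by (simp add: numeral_2_eq_2)

text \<open>Prepending \<open>F (Suc n)\<close> to both products yields the next pair, with the
  roles of \<open>c\<close> and \<open>d\<close> exchanged.\<close>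

lemma fib_string_commute_upto_2:
  "\<exists>p c d. F n @ F (Suc n) = p @ [c, d] \<and> F (Suc n) @ F n = p @ [d, c]"
proof (induction n)
  case (Suc n)
  then obtain p c d where "F n @ F (Suc n) = p @ [c, d]" "F (Suc n) @ F n = p @ [d, c]"
    by blast
  then have "F (Suc n) @ F (Suc (Suc n)) = (F (Suc n) @ p) @ [d, c]"
      "F (Suc (Suc n)) @ F (Suc n) = (F (Suc n) @ p) @ [c, d]"
    by (metis append.assoc fib_string.simps(3))+
  then show ?case by blast
qed auto

text \<open>After cancelling \<open>F (Suc k)\<close>, the string \<open>F k @ x\<close> has to
  start \<open>F (Suc k) @ F k\<close>. It does, since it ends before the two letters in which this
  product differs from \<open>F k @ F (Suc k)\<close>.\<close>

lemma prefix_shifted_seed: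
  assumes "1 \<le> k" "prefix x (take (f (Suc k) - 2) (F (Suc k)))"
  shows "prefix (F (Suc (Suc k)) @ x) (F (Suc k) @ F (Suc (Suc k)))"
proof -
  obtain p c d where p: "F k @ F (Suc k) = p @ [c, d]" "F (Suc k) @ F k = p @ [d, c]"
    using fib_string_commute_upto_2 by blast
  have "f k + f (Suc k) = length p + 2"
    using arg_cong[OF p(1), of length] by simp
  then have len: "length p = f k + (f (Suc k) - 2)"
    using length_fib_string_ge_2[of "Suc k"] assms(1) by linarith
  have "F k @ take (f (Suc k) - 2) (F (Suc k)) = take (length p) (F k @ F (Suc k))"
    by (simp add: len)
  also have "\<dots> = p" by (simp add: p(1))
  finally have "prefix (F k @ x) p"
    using assms(2) by (metis same_prefix_prefix)
  then have "prefix (F k @ x) (F (Suc k) @ F k)"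
    unfolding p(2) by (rule prefix_prefix)
  then show ?thesis by simp
qed

text \<open>\<open>F n\<close> splits recursively into blocks \<open>F (Suc k)\<close> and
  \<open>F (Suc (Suc k))\<close>, none longer than \<open>s\<close>, which are prepended from right
  to left. \<open>z\<close> is generalized because \<open>F (Suc i)\<close> is prepended to
  \<open>F i @ z\<close>.\<close>

lemma is_cover_fib_string_append:
  assumes s: "s = F (Suc (Suc k)) @ x" and k: "1 \<le> k"
    and x: "prefix x (take (f (Suc k) - 2) (F (Suc k)))"
    and z: "is_cover s z" and n: "Suc k \<le> n"
  shows "is_cover s (F n @ z)"
  using n z
proof (induction n arbitrary: z rule: less_induct)
  case (less n)
  have sz: "prefix s z" using less.prems(2) by (rule is_cover_imp_prefix)
  then have mz: "prefix (F (Suc (Suc k))) z"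
    unfolding s by (rule append_prefixD)
  consider "n = Suc k" | "n = Suc (Suc k)" | i where "n = Suc (Suc i)" "Suc k \<le> i"
    using less.prems(1) by (cases n rule: fib_string.cases) force+
  then show ?case
  proof cases
    case 1
    have "prefix s (F n @ F (Suc (Suc k)))"
      unfolding s 1 using k x by (rule prefix_shifted_seed)
    then have "prefix s (F n @ z)"
      using mz by (metis prefix_order.trans same_prefix_prefix)
    then show ?thesis
      using less.prems(2) by (intro is_cover_append_left) (auto simp: s 1)
  next
    case 2
    have "prefix x (F (Suc k))"
      using x take_is_prefix prefix_order.trans by blast
    then have "prefix x z"
      using prefix_order.trans[OF prefix_fib_string_Suc[of "Suc k"] mz] prefix_order.trans by force
    then show ?thesis
      using less.prems(2) by (intro is_cover_append_left) (auto simp: s 2)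
  next
    case 3
    have "is_cover s (F (Suc i) @ (F i @ z))"
      using less.IH 3 less.prems(2) by simp
    then show ?thesis by (simp add: 3)
  qed
qed

lemma left_seed_small:
  assumes "3 \<le> m" "m < n" "prefix x (take (f (m - 1) - 2) (F (m - 1)))"
  shows "left_seed (F m @ x) (F n)"
proof -
  obtain k where m: "m = Suc (Suc k)" and k: "1 \<le> k"
    using assms(1) by (cases m rule: fib_string.cases) auto
  have x: "prefix x (take (f (Suc k) - 2) (F (Suc k)))"
    using assms(3) by (simp add: m)
  \<comment> \<open>One full copy of the seed after \<open>F n\<close> is the cover to start from;
    occurrences overrunning \<open>F n\<close> end within it.\<close>
  have "is_cover (F m @ x) (F n @ (F m @ x))"
    by (rule is_cover_fib_string_append[OF _ k x is_cover_refl])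
      (use assms(2) m fib_string_nonempty in auto)
  moreover have "prefix x (F (Suc k))"
    using x take_is_prefix prefix_order.trans by blast
  then have "prefix (F m @ x) (F (Suc m))"
    by (simp add: m)
  then have "prefix (F m @ x) (F n)"
    using prefix_fib_string[of "Suc m" n] assms(2) prefix_order.trans by force
  ultimately show ?thesis
    by (intro left_seedI[of _ "F n @ (F m @ x)"]) auto
qed

lemma left_seed_large:
  assumes "3 \<le> n" "prefix x (F (n - 2))"
  shows "left_seed (F (n - 1) @ x) (F n)"
proof -
  let ?s = "F (n - 1) @ x"
  have n: "F n = F (n - 1) @ F (n - 2)"
    using assms(1) by (intro fib_string_rec) simp
  have pre: "prefix (F (n - 2)) (F (n - 1))"
    using assms(1) by (intro prefix_fib_string) auto
  then have "prefix x ?s"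
    using assms(2) by (meson prefix_order.trans prefix_prefix)
  \<comment> \<open>Two copies of \<open>?s\<close> at distance \<open>f (n - 1)\<close> already
    cover an extension of \<open>F n\<close>.\<close>
  then have "is_cover ?s (F (n - 1) @ ?s)"
    using fib_string_nonempty by (intro is_cover_append_left is_cover_refl) auto
  moreover have "prefix (F n) (F (n - 1) @ ?s)"
    using pre by (simp add: n)
  moreover have "prefix ?s (F n)"
    using assms(2) by (simp add: n)
  ultimately show ?thesis by (rule left_seedI)
qed

section \<open>Primitivity and periods\<close>

lemma count_fib_string_Suc:
  "count_list (F (Suc n)) Letter_a = count_list (F n) Letter_a + count_list (F n) Letter_b"
  "count_list (F (Suc n)) Letter_b = count_list (F n) Letter_a"
  by (induction n rule: fib_string.induct) auto

lemma coprime_count_fib_string: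
  "coprime (count_list (F n) Letter_a) (count_list (F n) Letter_b)"
proof (induction n)
  case (Suc n)
  then show ?case
    using gcd_add1[of "count_list (F n) Letter_b" "count_list (F n) Letter_a"]
    unfolding count_fib_string_Suc coprime_iff_gcd_eq_1
    by (simp only: add.commute gcd.commute)
qed simp

lemma count_list_concat_replicate:
  "count_list (concat (replicate n xs)) c = n * count_list xs c"
  by (induction n) auto

text \<open>A nontrivial rotation fixing \<open>F n\<close> makes its two parts commute, so both are
  powers of one word. Then \<open>F n\<close> is a power with exponent at least 2, which divides
  both letter counts, although these are coprime.\<close>

lemma fib_string_primitive:
  assumes "0 < j" "j < f n"
  shows "rotate j (F n) \<noteq> F n"
proof
  assume "rotate j (F n) = F n"
  then have "take j (F n) @ drop j (F n) = drop j (F n) @ take j (F n)"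
    using assms(2) by (simp add: rotate_drop_take)
  then obtain p q zs where pq: "concat (replicate p zs) = take j (F n)"
      "concat (replicate q zs) = drop j (F n)"
    using comm_append_are_replicate by blast
  have "0 < p" "0 < q"
    using pq assms by (auto intro!: Nat.gr0I)
  have "F n = concat (replicate (p + q) zs)"
    unfolding replicate_add concat_append pq by simp
  then have "p + q dvd count_list (F n) c" for c
    by (simp add: count_list_concat_replicate)
  then have "is_unit (p + q)"
    using coprime_count_fib_string coprime_common_divisor by blast
  then show False
    using \<open>0 < p\<close> \<open>0 < q\<close> by simp
qed

lemma eq_if_butlast_eq_mset_eq:
  assumes "butlast xs = butlast ys" "mset xs = mset ys"
  shows "xs = ys"
proof (cases "xs = []")
  case False
  moreover from this have "ys \<noteq> []" using assms(2) by auto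
  ultimately have "xs = butlast xs @ [last xs]" "ys = butlast xs @ [last ys]"
    using assms(1) append_butlast_last_id by metis+
  then show ?thesis using assms(2)
    by (metis add_left_cancel mset_append mset_single_iff_right)
qed (use assms in auto)

text \<open>\<open>F (Suc k)\<close> is a prefix of \<open>F k @ F k\<close>, whose factors of
  length at most \<open>f k\<close> are prefixes of rotations of \<open>F k\<close>.\<close>

lemma take_drop_fib_string_Suc:
  assumes "2 \<le> k" "j < f k" "j + l \<le> f (Suc k)" "l \<le> f k"
  shows "take l (drop j (F (Suc k))) = take l (rotate j (F k))"
proof -
  obtain i where k: "k = Suc i" "1 \<le> i" using assms(1) by (cases k) auto
  obtain t where t: "F k = F i @ t"
    using prefix_fib_string_Suc[of i] k by (auto simp: prefix_def)
  have FF: "F k @ F k = F (Suc k) @ t"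
    using t k by simp
  have "take l (drop j (F (Suc k))) = take l (drop j (F k @ F k))"
    unfolding FF using assms(3) by simp
  also have "\<dots> = take l (drop j (F k) @ F k)"
    using assms(2) by simp
  also have "\<dots> = take l (rotate j (F k))"
    using assms(2,4) by (auto simp: rotate_drop_take min_def)
  finally show ?thesis .
qed

text \<open>Vacuously true for \<open>p \<ge> length w\<close>.\<close>

definition has_period :: "nat \<Rightarrow> 'a list \<Rightarrow> bool" where
  "has_period p w \<longleftrightarrow> (\<forall>i. i + p < length w \<longrightarrow> w ! (i + p) = w ! i)"

text \<open>Suppose \<open>p\<close> is smaller. If \<open>p \<le> f (k - 2)\<close>, then
  \<open>F (k - 1)\<close> recurs at offset \<open>p\<close> inside \<open>F k\<close> and equals
  its own rotation. Otherwise \<open>F (k - 2)\<close> inherits a period that is too small, hence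
  the strong induction.\<close>

lemma has_period_fib_string_ge:
  assumes "2 \<le> k" "0 < p" "has_period p (F k)"
  shows "f (k - 1) \<le> p"
  using assms
proof (induction k arbitrary: p rule: less_induct)
  case (less k)
  have per: "F k ! (i + p) = F k ! i" if "i + p < f k" for i
    using less.prems(3) that by (auto simp: has_period_def)
  show ?case
  proof (rule ccontr)
    assume "\<not> f (k - 1) \<le> p"
    then have lt: "p < f (k - 1)" by simp
    have k: "F k = F (k - 1) @ F (k - 2)"
      using less.prems(1) by (rule fib_string_rec)
    have k3: "3 \<le> k"
    proof (rule ccontr)
      assume "\<not> 3 \<le> k"
      then have "k = 2" using less.prems(1) by simp
      then show False using lt less.prems(2) by simp
    qed
    show False
    proof (cases "p \<le> f (k - 2)")
      case True
      have "take (f (k - 1)) (drop p (F k)) = F (k - 1)"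
      proof (rule nth_equalityI)
        fix i assume "i < length (take (f (k - 1)) (drop p (F k)))"
        then have i: "i < f (k - 1)" by simp
        then have "i + p < f k" using True k by simp
        then show "take (f (k - 1)) (drop p (F k)) ! i = F (k - 1) ! i"
          using i per[of i] by (simp add: add.commute) (simp add: k nth_append)
      qed (use True k in simp)
      moreover have "take (f (k - 1)) (drop p (F k)) = take (f (k - 1)) (rotate p (F (k - 1)))"
        using take_drop_fib_string_Suc[of "k - 1" p "f (k - 1)"] k3 lt True k by simp
      ultimately have "rotate p (F (k - 1)) = F (k - 1)" by simp
      then show False using fib_string_primitive[OF less.prems(2) lt] by simp
    next
      case False
      \<comment> \<open>The border of length \<open>f k - p\<close> begins and ends with \<open>F (k - 2)\<close>, so \<open>F (k - 2)\<close> overlaps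
        itself with the too small shift \<open>d\<close>.\<close>
      define d where "d = f (k - 1) - p"
      have k1: "F (k - 1) = F (k - 2) @ F (k - 3)"
        using fib_string_rec[of "k - 1"] k3 by (simp add: numeral_eq_Suc)
      have d: "0 < d" "d < f (k - 3)"
        using lt False k1 by (auto simp: d_def)
      \<comment> \<open>For \<open>k = 3\<close> and \<open>k = 4\<close>, \<open>f (k - 3)\<close>
        is 1, which leaves no room for \<open>d\<close>.\<close>
      have k5: "5 \<le> k"
      proof (rule ccontr)
        assume "\<not> 5 \<le> k"
        then have "k = 3 \<or> k = 4" using k3 by auto
        then show False using d by (auto simp: numeral_eq_Suc)
      qed
      have "has_period d (F (k - 2))"
        unfolding has_period_def
      proof (intro allI impI)
        fix i assume i: "i + d < f (k - 2)"
        have "F (k - 2) ! i = F k ! (i + f (k - 1))"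
          by (simp add: k nth_append)
        also have "i + f (k - 1) = (i + d) + p"
          using lt by (simp add: d_def)
        also have "F k ! \<dots> = F k ! (i + d)"
          using i lt by (intro per) (simp add: k d_def)
        also have "\<dots> = F (k - 2) ! (i + d)"
          using i unfolding k k1 by (simp add: nth_append)
        finally show "F (k - 2) ! (i + d) = F (k - 2) ! i" by simp
      qed
      moreover have "2 \<le> k - 2" "k - 2 < k" using k5 by linarith+
      ultimately have "f (k - 2 - 1) \<le> d"
        using less.IH[of "k - 2" d] d(1) by blast
      then show False using d by (simp add: numeral_eq_Suc)
    qed
  qed
qed

lemma not_left_seed_butlast:
  assumes "2 \<le> k"
  shows "\<not> left_seed (butlast (F k)) (F (Suc k))"
proof
  define x where "x = butlast (F k)"
  have lenx: "length x = f k - 1" by (simp add: x_def)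
  have fk: "2 \<le> f k" using assms by (rule length_fib_string_ge_2)
  have k: "F (Suc k) = F k @ F (k - 1)"
    using fib_string_rec[of "Suc k"] assms by simp
  assume "left_seed (butlast (F k)) (F (Suc k))"
  then have "left_seed x (F (Suc k))" by (simp add: x_def)
  moreover have "f k - 1 < f (Suc k)" using fk by (simp add: k)
  \<comment> \<open>Offset \<open>f k - 1\<close> lies just beyond the initial occurrence of
    \<open>x\<close>, which forces \<open>j > 0\<close>.\<close>
  ultimately obtain v j where j: "j \<le> f k - 1" "f k - 1 < j + length x"
      and occ: "take (length x) (drop j (F (Suc k) @ v)) = x"
    by (rule left_seed_covers)
  have j0: "0 < j" "j < f k" using j lenx fk by auto
  show False
  proof (cases "j + length x \<le> f (Suc k)")
    case True
    then have "take (length x) (drop j (F (Suc k))) = x"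
      using occ by simp
    then have "take (f k - 1) (rotate j (F k)) = butlast (F k)"
      using take_drop_fib_string_Suc[OF assms j0(2) True] lenx by (simp add: x_def)
    then have "butlast (rotate j (F k)) = butlast (F k)"
      by (simp add: butlast_conv_take)
    \<comment> \<open>The rotation agrees with \<open>F k\<close> up to the last letter, and equal
      letter counts settle that one.\<close>
    moreover have "mset (rotate j (F k)) = mset (F k)"
      using j0(2) by (simp add: rotate_drop_take)
        (metis add.commute append_take_drop_id mset_append)
    ultimately have "rotate j (F k) = F k"
      by (rule eq_if_butlast_eq_mset_eq)
    then show False using fib_string_primitive[OF j0] by simp
  next
    case False
    \<comment> \<open>The occurrence overruns \<open>F (Suc k)\<close>, so comparing it with the
      prefix \<open>x\<close> reaches all pairs of letters at distance \<open>j\<close>.\<close>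
    have "has_period j (F (Suc k))"
      unfolding has_period_def
    proof (intro allI impI)
      fix i assume i: "i + j < f (Suc k)"
      then have ix: "i < length x" using False by simp
      have "x ! i = (F (Suc k) @ v) ! (j + i)"
        using arg_cong[OF occ, of "\<lambda>u. u ! i"] ix i
        by (simp del: take_append drop_append)
      also have "\<dots> = F (Suc k) ! (i + j)"
        using i by (simp add: nth_append add.commute)
      finally show "F (Suc k) ! (i + j) = F (Suc k) ! i"
        using ix by (simp add: x_def k nth_append nth_butlast)
    qed
    then show False
      using has_period_fib_string_ge[of "Suc k" j] j0 assms by simp
  qed
qed

section \<open>All left seeds\<close>

text \<open>A seed shorter than \<open>F (n - 1)\<close> lies between some \<open>F m\<close> and
  \<open>F (Suc m)\<close>. It is also a left seed of the prefix \<open>F (m + 2)\<close> of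
  \<open>F n\<close>, which rules out length \<open>f (Suc m) - 1\<close>.\<close>

lemma left_seed_fib_string_cases:
  assumes "2 \<le> n" "left_seed s (F n)"
  obtains (large) x where "s = F (n - 1) @ x" "prefix x (F (n - 2))"
  | (small) m x where "3 \<le> m" "m \<le> n - 2" "s = F m @ x"
      "prefix x (take (f (m - 1) - 2) (F (m - 1)))"
proof -
  have s: "s \<noteq> []" "prefix s (F n)" using assms(2) by (auto simp: left_seed_def)
  have n: "F n = F (n - 1) @ F (n - 2)" using assms(1) by (rule fib_string_rec)
  show thesis
  proof (cases "f (n - 1) \<le> length s")
    case True
    have "prefix (F (n - 1)) s"
      by (rule prefix_length_prefix[OF _ s(2) True]) (simp add: n)
    then obtain x where "s = F (n - 1) @ x" by (auto simp: prefix_def)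
    then show thesis using large[of x] s(2) n by simp
  next
    case False
    have "\<exists>m<n - 1. f m \<le> length s \<and> length s < f (Suc m) \<and> 1 \<le> m"
    proof -
      \<comment> \<open>Index 0 is left out because \<open>F 0\<close> is not a prefix of the later
        strings.\<close>
      let ?Q = "\<lambda>i. 1 \<le> i \<and> length s < f i"
      define i where "i = (LEAST i. ?Q i)"
      have "?Q (n - 1)" using False assms(1) by simp
      then have i: "?Q i" "i \<le> n - 1"
        unfolding i_def by (rule LeastI, rule Least_le)
      have "i \<noteq> 1"
        using i(1) s(1) by auto
      then obtain m where m: "i = Suc m" "1 \<le> m" using i(1) by (cases i) auto
      then have "\<not> ?Q m" unfolding i_def by (metis lessI not_less_Least)
      then show ?thesis using i m by (intro exI[of _ m]) auto
    qed
    then obtain m where m: "m < n - 1" "f m \<le> length s" "length s < f (Suc m)" "1 \<le> m"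
      by blast
    have pm: "prefix (F i) (F n)" if "1 \<le> i" "i \<le> m + 2" for i
      using that m by (intro prefix_fib_string) auto
    have "prefix s (F (Suc m))"
      using prefix_length_prefix[OF s(2) pm[of "Suc m"]] m by simp
    then obtain t where t: "F (Suc m) = s @ t" by (auto simp: prefix_def)
    have "length s \<noteq> f (Suc m) - 1"
    proof
      assume "length s = f (Suc m) - 1"
      then have "s = butlast (F (Suc m))"
        using t by (simp add: butlast_conv_take)
      moreover have "left_seed s (F (Suc (Suc m)))"
        using left_seed_prefix[OF assms(2) _ pm[of "Suc (Suc m)"]] t by simp
      ultimately show False using not_left_seed_butlast[of "Suc m"] m(4) by simp
    qed
    then have len: "length s \<le> f (Suc m) - 2" using m(3) by simp
    \<comment> \<open>The bound \<open>f (Suc m) - 2\<close> is 0 for \<open>m = 1\<close>, and 1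
      for \<open>m = 2\<close>, where \<open>f m\<close> is 2.\<close>
    have m3: "3 \<le> m"
    proof (rule ccontr)
      assume "\<not> 3 \<le> m"
      then have "m = 1 \<or> m = 2" using m(4) by auto
      then show False using len m(2) s(1) by (auto simp: numeral_eq_Suc)
    qed
    have Sm: "F (Suc m) = F m @ F (m - 1)" using m(4) fib_string_rec[of "Suc m"] by simp
    have "prefix (F m) s"
      using prefix_length_prefix[OF pm[of m] s(2) m(2)] m(4) by simp
    then obtain x where x: "s = F m @ x" by (auto simp: prefix_def)
    have "F (m - 1) = x @ t" using t Sm x by simp
    moreover have "length x \<le> f (m - 1) - 2" using len x Sm by simp
    ultimately have "prefix x (take (f (m - 1) - 2) (F (m - 1)))"
      by simp
    then show thesis using small[of m x] m3 m(1) x by simp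
  qed
qed

lemma left_seeds_singleton: "{s. left_seed s [c]} = {[c]}"
proof -
  have "s = [c]" if "left_seed s [c]" for s
    using that by (auto simp: left_seed_def prefix_Cons)
  then show ?thesis using left_seed_refl[of "[c]"] by auto
qed

lemma left_seeds_fib_string_2: "{s. left_seed s [Letter_a, Letter_b]} = {[Letter_a, Letter_b]}"
proof -
  have "\<not> left_seed [Letter_a] [Letter_a, Letter_b]"
  proof
    assume "left_seed [Letter_a] [Letter_a, Letter_b]"
    then obtain v j where "j \<le> 1" "1 < j + length [Letter_a]"
        "take (length [Letter_a]) (drop j ([Letter_a, Letter_b] @ v)) = [Letter_a]"
      by (rule left_seed_covers[of _ _ 1]) auto
    moreover from this have "j = 1" by simp
    ultimately show False by simp
  qed
  moreover have "s = [Letter_a] \<or> s = [Letter_a, Letter_b]"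
    if "left_seed s [Letter_a, Letter_b]" for s
    using that by (auto simp: left_seed_def prefix_Cons)
  ultimately show ?thesis using left_seed_refl[of "[Letter_a, Letter_b]"] by auto
qed

text \<open>Starting at 3 makes \<open>n = 3\<close> an instance, with an empty union.\<close>

lemma left_seeds_fib_string_ge_3:
  assumes "3 \<le> n"
  shows "{s. left_seed s (F n)} =
       {F (n - 1) @ x | x. prefix x (F (n - 2))} \<union>
       (\<Union>m\<in>{3..n - 2}. {F m @ x | x. prefix x (take (f (m - 1) - 2) (F (m - 1)))})"
    (is "_ = ?R")
proof (intro equalityI subsetI)
  fix s assume "s \<in> {s. left_seed s (F n)}"
  then have "left_seed s (F n)" by simp
  then show "s \<in> ?R"
    using assms by (cases rule: left_seed_fib_string_cases[rotated]) auto
next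
  fix s assume "s \<in> ?R"
  then show "s \<in> {s. left_seed s (F n)}"
    using left_seed_large[OF assms] left_seed_small by auto
qed

theorem theorem2:
  fixes n :: nat
  shows "(n \<in> {0, 1, 2} \<longrightarrow> {s. left_seed s (fib_string n)} = {fib_string n}) \<and>
    (n = 3 \<longrightarrow> {s. left_seed s (fib_string n)} =
       {[Letter_a, Letter_b], [Letter_a, Letter_b, Letter_a]}) \<and>
    (n \<ge> 4 \<longrightarrow> {s. left_seed s (fib_string n)} =
       {fib_string (n - 1) @ x | x. prefix x (fib_string (n - 2))} \<union>
       (\<Union>m\<in>{3..n - 2}. {fib_string m @ x | x.
          prefix x (factor (fib_string (m - 1)) 1 (length (fib_string (m - 1)) - 2))}))"
proof (intro conjI impI)
  assume "n \<in> {0, 1, 2}"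
  then show "{s. left_seed s (F n)} = {F n}"
    by (elim insertE emptyE) (simp_all add: left_seeds_singleton left_seeds_fib_string_2 numeral_2_eq_2)
next
  assume "n = 3"
  then have "{s. left_seed s (F n)} = {F 2 @ x | x. prefix x (F 1)}"
    using left_seeds_fib_string_ge_3[of 3] by simp
  also have "\<dots> = {[Letter_a, Letter_b], [Letter_a, Letter_b, Letter_a]}"
    by (auto simp: numeral_2_eq_2 prefix_Cons)
  finally show "{s. left_seed s (F n)} = {[Letter_a, Letter_b], [Letter_a, Letter_b, Letter_a]}" .
next
  assume "n \<ge> 4"
  then show "{s. left_seed s (F n)} =
       {F (n - 1) @ x | x. prefix x (F (n - 2))} \<union>
       (\<Union>m\<in>{3..n - 2}. {F m @ x | x. prefix x (factor (F (m - 1)) 1 (f (m - 1) - 2))})"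
    by (simp add: left_seeds_fib_string_ge_3 factor_def)
qed

end
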